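(* Let $G=(V,E)$ be a connected graph on $n\ge5$ nodes with a planted bisection $V_1,V_2$, and let $E_0$ be the set of edges of $G$ with one end in $V_1$ and the other in $V_2$. Define $$c(G):=\max\left\{0,\ \frac{3\rho_{\max}(G)-4\rho_{\mathrm{avg}}(G)}{1-\frac4n}\right\}.$$ If $$\frac{1+c(G)}{2\rho_{\mathrm{avg}}(G)+2c(G)\left(1-\frac1n\right)}\,|E|<|E_0|,$$ then the LP relaxation does not recover the planted bisection.
   Context: Graphs are finite, simple and undirected, with $V=\{1,\dots,n\}$. A bisection of $V$ is a partition of $V$ into two subsets of equal cardinality (so $n$ is even); a fixed bisection $V_1,V_2$ is called the planted bisection. For a graph $G$, $\rho_G(i,j)$ is the length of a shortest path from $i$ to $j$ in $G$; $\rho_{\max}(G)=\max_{i,j\in V}\rho_G(i,j)$ is the diameter and $\rho_{\mathrm{avg}}(G)=\frac{2}{n^2}\sum_{1\le i<j\le n}\rho_G(i,j)$ is the average distance. The LP relaxation (metric relaxation of the minimum bisection problem) associated with $G$ is the following linear program in $x\in\mathbb R^{\binom n2}$, with coordinates $x_{ij}$, $1\le i<j\le n$, and the convention $x_{ji}:=x_{ij}$: $$\min\ \sum_{1\le i<j\le n}a_{ij}x_{ij}$$ subject to $x_{ij}\le x_{ik}+x_{jk}$ for all distinct $i,j,k\in\{1,\dots,n\}$ with $i<j$; $x_{ij}+x_{ik}+x_{jk}\le 2$ for all $1\le i<j<k\le n$; and $\sum_{1\le i<j\le n}x_{ij}=n^2/4$. Here $a_{ij}=1$ if $\{i,j\}\in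 E$ and $a_{ij}=0$ otherwise. The cut vector corresponding to the planted bisection is $\bar x\in\{0,1\}^{\binom n2}$ with $\bar x_{ij}=0$ if $i,j$ are in the same set of the bisection and $\bar x_{ij}=1$ otherwise. The LP relaxation recovers the planted bisection if $\bar x$ is its unique optimal solution. *)

theory Defs
  imports
    "Graph_Theory.Digraph_Component"
    "Graph_Theory.Shortest_Path"
    "HOL-Library.FuncSet"
begin

text \<open>A finite simple undirected graph is a \<open>pair_graph\<close>: a finite loop-free digraph without
  multiple arcs whose arc relation is symmetric. Every undirected edge is thus represented by
  two arcs, and counting edges has to be done on unordered pairs.\<close>

definition edges :: "'a pair_pre_digraph \<Rightarrow> 'a set set" where
  "edges G = {{u, v} | u v. (u, v) \<in> parcs G}"

definition cut_edges :: "'a pair_pre_digraph \<Rightarrow> 'a set \<Rightarrow> 'a set \<Rightarrow> 'a set set" where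
  "cut_edges G V1 V2 = {e \<in> edges G. \<exists>u\<in>V1. \<exists>v\<in>V2. e = {u, v}}"

definition bisection :: "'a set \<Rightarrow> 'a set \<Rightarrow> 'a set \<Rightarrow> bool" where
  "bisection V V1 V2 \<longleftrightarrow> V1 \<union> V2 = V \<and> V1 \<inter> V2 = {} \<and> card V1 = card V2"

text \<open>\<open>\<mu>\<close> with unit weights is the length of a shortest path. It is infinite between
  different components, where \<open>real_of_ereal\<close> yields the junk value \<open>0\<close>, so the following
  notions are only meaningful for connected graphs.\<close>

definition rho :: "'a pair_pre_digraph \<Rightarrow> 'a \<Rightarrow> 'a \<Rightarrow> real" where
  "rho G i j = real_of_ereal (wf_digraph.\<mu> (with_proj G) (\<lambda>_. 1) i j)"

definition rho_max :: "'a pair_pre_digraph \<Rightarrow> real" where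
  "rho_max G = Max {rho G i j | i j. i \<in> pverts G \<and> j \<in> pverts G}"

definition index_pairs :: "nat \<Rightarrow> (nat \<times> nat) set" where
  "index_pairs n = {(i, j). 1 \<le> i \<and> i < j \<and> j \<le> n}"

text \<open>From here on the vertex set of a graph is assumed to be \<open>{1..n}\<close>,
  so that \<open>n = card (pverts G)\<close>.\<close>

definition rho_avg :: "nat pair_pre_digraph \<Rightarrow> real" where
  "rho_avg G = (let n = card (pverts G) in
     2 / real n ^ 2 * (\<Sum>(i, j)\<in>index_pairs n. rho G i j))"

definition c_graph :: "nat pair_pre_digraph \<Rightarrow> real" where
  "c_graph G = max 0 ((3 * rho_max G - 4 * rho_avg G) / (1 - 4 / real (card (pverts G))))"

text \<open>Vectors with coordinates indexed by the pairs \<open>i < j\<close> are extensional functions on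
  \<open>index_pairs n\<close>, so that equality of functions is equality of vectors.
  \<open>coord\<close> realises the convention that \<open>x\<close> at \<open>(j, i)\<close> means \<open>x\<close> at \<open>(i, j)\<close>.\<close>

definition coord :: "(nat \<times> nat \<Rightarrow> real) \<Rightarrow> nat \<Rightarrow> nat \<Rightarrow> real" where
  "coord x i j = x (min i j, max i j)"

definition lp_feasible :: "nat \<Rightarrow> (nat \<times> nat \<Rightarrow> real) \<Rightarrow> bool" where
  "lp_feasible n x \<longleftrightarrow>
     x \<in> extensional (index_pairs n) \<and>
     (\<forall>i\<in>{1..n}. \<forall>j\<in>{1..n}. \<forall>k\<in>{1..n}. i < j \<and> k \<noteq> i \<and> k \<noteq> j \<longrightarrow>
        coord x i j \<le> coord x i k + coord x j k) \<and>
     (\<forall>i\<in>{1..n}. \<forall>j\<in>{1..n}. \<forall>k\<in>{1..n}. i < j \<and> j < k \<longrightarrow>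
        coord x i j + coord x i k + coord x j k \<le> 2) \<and>
     (\<Sum>(i, j)\<in>index_pairs n. coord x i j) = real n ^ 2 / 4"

definition lp_objective :: "nat pair_pre_digraph \<Rightarrow> (nat \<times> nat \<Rightarrow> real) \<Rightarrow> real" where
  "lp_objective G x = (\<Sum>(i, j)\<in>index_pairs (card (pverts G)).
     (if {i, j} \<in> edges G then 1 else 0) * coord x i j)"

definition lp_optimal :: "nat pair_pre_digraph \<Rightarrow> (nat \<times> nat \<Rightarrow> real) \<Rightarrow> bool" where
  "lp_optimal G x \<longleftrightarrow> is_arg_min (lp_objective G) (lp_feasible (card (pverts G))) x"

definition cut_vector :: "nat \<Rightarrow> nat set \<Rightarrow> nat set \<Rightarrow> nat \<times> nat \<Rightarrow> real" where
  "cut_vector n V1 V2 = restrict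
     (\<lambda>(i, j). if i \<in> V1 \<and> j \<in> V1 \<or> i \<in> V2 \<and> j \<in> V2 then 0 else 1) (index_pairs n)"

definition lp_recovers :: "nat pair_pre_digraph \<Rightarrow> nat set \<Rightarrow> nat set \<Rightarrow> bool" where
  "lp_recovers G V1 V2 \<longleftrightarrow>
     (\<forall>x. lp_optimal G x \<longleftrightarrow> x = cut_vector (card (pverts G)) V1 V2)"

end

theory Submission
  imports Defs
begin

text \<open>
  The translated and rescaled metric \<open>(\<rho> + c) / K\<close> with
  \<open>K = 2 \<rho>\<^sub>a\<^sub>v\<^sub>g + 2 c (1 - 1/n)\<close> satisfies the triangle inequalities because \<open>c \<ge> 0\<close> and the
  normalisation by the choice of \<open>K\<close>. The perimeter inequalities
  \<open>3 \<rho>\<^sub>m\<^sub>a\<^sub>x + 3 c \<le> 2 K\<close> amount to \<open>3 \<rho>\<^sub>m\<^sub>a\<^sub>x - 4 \<rho>\<^sub>a\<^sub>v\<^sub>g \<le> c (1 - 4/n)\<close>, which is how \<open>c\<close> was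
  chosen. Every edge has length \<open>\<le> (1 + c) / K\<close> in it, so by hypothesis its objective value
  is smaller than the value \<open>|E\<^sub>0|\<close> of the cut vector, which is therefore not optimal.
\<close>

section \<open>Graph distance as the length of a shortest walk\<close>

context wf_digraph
begin

lemma awalk_cost_unit: "awalk_cost (\<lambda>_. 1) p = real (length p)"
  by (induction p) auto

end

context pair_graph
begin

text \<open>Arcs come in opposite pairs, so the first arc can be reversed and appended to the
  reversal of the rest. This is the source of the symmetry of \<open>rho\<close>.\<close>

lemma awalk_rev:
  assumes "awalk u p v"
  shows "\<exists>q. awalk v q u \<and> length q = length p"
  using assms
proof (induction p arbitrary: u)
  case Nil
  then show ?case by (auto simp: awalk_Nil_iff)
next
  case (Cons e p)
  obtain w where e: "e = (u, w)" "(u, w) \<in> parcs G" "awalk w p v"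
    using Cons.prems by (cases e) (auto simp: awalk_Cons_iff)
  obtain q where q: "awalk v q w" "length q = length p"
    using Cons.IH[OF e(3)] by blast
  have "(w, u) \<in> parcs G"
    using pair_sym_arcs e(2) by (auto simp: symmetric_def sym_def)
  then have "awalk w [(w, u)] u"
    by (auto simp: awalk_Cons_iff awalk_Nil_iff dest: wellformed')
  then have "awalk v (q @ [(w, u)]) u"
    using q(1) by (rule awalk_appendI[rotated])
  then show ?case using q(2) by (intro exI[of _ "q @ [(w, u)]"]) simp
qed

text \<open>Connectedness is defined through the symmetric closure, which adds no arcs here because
  the arc relation is already symmetric.\<close>

lemma reachable_if_connected:
  assumes "Digraph_Component.connected (with_proj G)" "u \<in> pverts G" "v \<in> pverts G"
  shows "u \<rightarrow>\<^sup>*\<^bsub>with_proj G\<^esub> v"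
proof -
  have "u \<rightarrow>\<^sup>*\<^bsub>with_proj (mk_symmetric (with_proj G))\<^esub> v"
    using assms by (auto simp: Digraph_Component.connected_def strongly_connected_def mk_symmetric_def)
  then show ?thesis using reachable_mk_symmetric_eq[OF pair_sym_arcs] by blast
qed

text \<open>Unit costs admit no negative cycle and \<open>v\<close> is reachable from
  \<open>u\<close>, so the infimum \<open>\<mu>\<close> is attained by a path. In particular it is
  finite, and \<open>real_of_ereal\<close> in \<open>rho\<close> never falls back on its default
  value.\<close>

lemma mu_unit_eq_length:
  assumes "Digraph_Component.connected (with_proj G)" "u \<in> pverts G" "v \<in> pverts G"
  shows "\<exists>p. awalk u p v \<and> \<mu> (\<lambda>_. 1) u v = ereal (real (length p))"
proof -
  have "\<exists>p. apath u p v \<and> \<mu> (\<lambda>_. 1) u v = awalk_cost (\<lambda>_. 1) p"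
    using reachable_if_connected[OF assms]
    by (rule no_neg_cyc_reach_imp_path) (auto simp: awalk_cost_unit)
  then show ?thesis by (auto simp: awalk_cost_unit apath_def)
qed

lemma rho_eq_length:
  assumes "Digraph_Component.connected (with_proj G)" "u \<in> pverts G" "v \<in> pverts G"
  shows "\<exists>p. awalk u p v \<and> rho G u v = real (length p)"
  using mu_unit_eq_length[OF assms] by (auto simp: rho_def)

lemma rho_le_length:
  assumes "Digraph_Component.connected (with_proj G)" "awalk u p v"
  shows "rho G u v \<le> real (length p)"
proof -
  have "u \<in> pverts G" "v \<in> pverts G" using assms(2) by auto
  from mu_unit_eq_length[OF assms(1) this]
  obtain q where "awalk u q v" "\<mu> (\<lambda>_. 1) u v = ereal (real (length q))" by blast
  then show ?thesis
    using min_cost_le_walk_cost[OF assms(2), of "\<lambda>_. 1"] by (simp add: awalk_cost_unit rho_def)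
qed

lemma rho_sym:
  assumes "Digraph_Component.connected (with_proj G)" "u \<in> pverts G" "v \<in> pverts G"
  shows "rho G u v = rho G v u"
proof -
  have le: "rho G x y \<le> rho G y x" if "x \<in> pverts G" "y \<in> pverts G" for x y
    using rho_eq_length[OF assms(1) that(2,1)] awalk_rev rho_le_length[OF assms(1)]
    by metis
  show ?thesis using le[OF assms(2,3)] le[OF assms(3,2)] by (rule antisym)
qed

lemma rho_triangle:
  assumes "Digraph_Component.connected (with_proj G)" "u \<in> pverts G" "v \<in> pverts G" "w \<in> pverts G"
  shows "rho G u w \<le> rho G u v + rho G v w"
proof -
  obtain p q where "awalk u p v" "rho G u v = real (length p)"
    "awalk v q w" "rho G v w = real (length q)"
    using rho_eq_length assms by meson
  then show ?thesis
    using rho_le_length[OF assms(1), of u "p @ q" w] awalk_appendI by simp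
qed

lemma rho_pos:
  assumes "Digraph_Component.connected (with_proj G)" "u \<in> pverts G" "v \<in> pverts G" "u \<noteq> v"
  shows "0 < rho G u v"
  using rho_eq_length[OF assms(1-3)] assms(4) by (auto simp: awalk_Nil_iff)

lemma rho_le_1:
  assumes "Digraph_Component.connected (with_proj G)" "{u, v} \<in> edges G"
  shows "rho G u v \<le> 1"
proof -
  have "(u, v) \<in> parcs G"
    using assms(2) pair_sym_arcs
    by (auto simp: edges_def doubleton_eq_iff symmetric_def sym_def)
  then have "awalk u [(u, v)] v"
    by (auto simp: awalk_Cons_iff awalk_Nil_iff dest: wellformed')
  then show ?thesis using rho_le_length[OF assms(1)] by force
qed

lemma rho_le_rho_max:
  assumes "u \<in> pverts G" "v \<in> pverts G"
  shows "rho G u v \<le> rho_max G"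
proof -
  \<comment> \<open>Written as an image of a finite product, the set is visibly finite, as
    \<open>Max_ge\<close> requires.\<close>
  have "{rho G i j | i j. i \<in> pverts G \<and> j \<in> pverts G}
      = (\<lambda>(i, j). rho G i j) ` (pverts G \<times> pverts G)"
    by auto
  then show ?thesis
    unfolding rho_max_def using assms pair_finite_verts by (intro Max_ge) auto
qed

lemma edges_subset: "edges G \<subseteq> {{u, v} | u v. u \<in> pverts G \<and> v \<in> pverts G \<and> u \<noteq> v}"
  by (auto simp: edges_def dest: wellformed' no_loops')

end

section \<open>Sums over index pairs and counts of unordered pairs\<close>

lemma finite_index_pairs: "finite (index_pairs n)"
  by (rule finite_subset[of _ "{1..n} \<times> {1..n}"]) (auto simp: index_pairs_def)

text \<open>Every two-element set has exactly one representative with \<open>i < j\<close>, so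
  \<open>(i, j) \<mapsto> {i, j}\<close> is a bijection from the pairs counted by the sum onto
  \<open>A\<close>.\<close>

lemma sum_edge_indicator:
  assumes "A \<subseteq> {{u, v} | u v. u \<in> {1..n} \<and> v \<in> {1..n} \<and> u \<noteq> v}"
  shows "(\<Sum>(i, j)\<in>index_pairs n. if {i, j} \<in> A then 1 else 0) = real (card A)"
proof -
  let ?f = "\<lambda>(i::nat, j). {i, j}" and ?P = "{p \<in> index_pairs n. (case p of (i, j) \<Rightarrow> {i, j}) \<in> A}"
  have inj: "inj_on ?f ?P"
    by (auto simp: inj_on_def index_pairs_def doubleton_eq_iff)
  have img: "?f ` ?P = A"
  proof (intro equalityI subsetI)
    fix e assume e: "e \<in> A"
    then obtain u v where "u \<in> {1..n}" "v \<in> {1..n}" "u \<noteq> v" "e = {u, v}"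
      using assms by blast
    then show "e \<in> ?f ` ?P" using e
      by (intro image_eqI[of _ _ "(min u v, max u v)"])
        (auto simp: index_pairs_def min_def max_def insert_commute)
  qed auto
  have "card A = card ?P" using card_image[OF inj] unfolding img .
  moreover have "(\<Sum>(i, j)\<in>index_pairs n. if {i, j} \<in> A then 1 else 0)
      = (\<Sum>p\<in>?P. 1::real)"
    using finite_index_pairs by (intro sum.mono_neutral_cong_right) (auto split: if_splits)
  ultimately show ?thesis by simp
qed

lemma card_index_pairs: "real (card (index_pairs n)) = real n * (real n - 1) / 2"
proof (induction n)
  case 0
  have "index_pairs 0 = {}" by (auto simp: index_pairs_def)
  then show ?case by simp
next
  case (Suc n)
  \<comment> \<open>The new pairs are those whose larger entry is \<open>Suc n\<close>.\<close>
  have "index_pairs (Suc n) = index_pairs n \<union> (\<lambda>i. (i, Suc n)) ` {1..n}"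
    by (auto simp: index_pairs_def)
  moreover have "card (index_pairs n \<union> (\<lambda>i. (i, Suc n)) ` {1..n})
      = card (index_pairs n) + card ((\<lambda>i. (i, Suc n)) ` {1..n})"
    using finite_index_pairs by (intro card_Un_disjoint) (auto simp: index_pairs_def)
  moreover have "card ((\<lambda>i. (i, Suc n)) ` {1..n}) = n"
    by (subst card_image) (auto simp: inj_on_def)
  ultimately show ?case using Suc by (simp add: field_simps)
qed

lemma coord_index_pair: "(i, j) \<in> index_pairs n \<Longrightarrow> coord x i j = x (i, j)"
  by (simp add: coord_def index_pairs_def min_def max_def)

section \<open>The cut vector and the rescaled metric as points of the LP\<close>

locale numbered_connected_graph = pair_graph G
  for G :: "nat pair_pre_digraph" +
  fixes n :: nat
  assumes pverts_eq: "pverts G = {1..n}"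
    and conn: "Digraph_Component.connected (with_proj G)"
begin

lemma lp_objective_cut_vector:
  assumes "bisection (pverts G) V1 V2"
  shows "lp_objective G (cut_vector n V1 V2) = real (card (cut_edges G V1 V2))"
proof -
  have V: "V1 \<union> V2 = {1..n}" "V1 \<inter> V2 = {}"
    using assms by (auto simp: bisection_def pverts_eq)
  have coord_cut: "(if {i, j} \<in> edges G then 1 else 0) * coord (cut_vector n V1 V2) i j
      = (if {i, j} \<in> cut_edges G V1 V2 then 1 else 0)" if ij: "(i, j) \<in> index_pairs n" for i j
  proof -
    have "i \<in> V1 \<union> V2" "j \<in> V1 \<union> V2" using ij V(1) by (auto simp: index_pairs_def)
    \<comment> \<open>Each endpoint lies in exactly one side, so a pair not contained in one side
      has an end in each.\<close>
    then have "(\<exists>u\<in>V1. \<exists>v\<in>V2. {i, j} = {u, v}) \<longleftrightarrow> \<not> (i \<in> V1 \<and> j \<in> V1 \<or> i \<in> V2 \<and> j \<in> V2)"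
      using V(2) by (auto simp: doubleton_eq_iff)
    then show ?thesis
      using ij by (simp add: cut_edges_def coord_index_pair cut_vector_def)
  qed
  have "lp_objective G (cut_vector n V1 V2)
      = (\<Sum>(i, j)\<in>index_pairs n. if {i, j} \<in> cut_edges G V1 V2 then 1 else 0)"
    unfolding lp_objective_def pverts_eq by (rule sum.cong) (use coord_cut in auto)
  also have "\<dots> = real (card (cut_edges G V1 V2))"
    using edges_subset pverts_eq by (intro sum_edge_indicator) (auto simp only: cut_edges_def)
  finally show ?thesis .
qed

lemma metric_lp_feasible:
  fixes c K :: real
  defines "y \<equiv> restrict (\<lambda>(i, j). (rho G i j + c) / K) (index_pairs n)"
  assumes "0 \<le> c" "0 < K"
    and K: "K = 2 * rho_avg G + 2 * c * (1 - 1 / real n)"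
    and perimeter: "3 * rho_max G + 3 * c \<le> 2 * K"
  shows "lp_feasible n y"
proof -
  \<comment> \<open>\<open>coord\<close> sorts its indices; the symmetry of \<open>rho\<close> makes
    the formula valid in either order.\<close>
  have y: "coord y i j = (rho G i j + c) / K" if "i \<in> {1..n}" "j \<in> {1..n}" "i \<noteq> j" for i j
    using that rho_sym[OF conn] pverts_eq
    by (auto simp: coord_def y_def index_pairs_def min_def max_def)
  have "coord y i j \<le> coord y i k + coord y j k"
    if "i \<in> {1..n}" "j \<in> {1..n}" "k \<in> {1..n}" "i < j" "k \<noteq> i" "k \<noteq> j" for i j k
  proof -
    \<comment> \<open>The shift occurs once on the left and twice on the right, so
      \<open>0 \<le> c\<close> only adds slack.\<close>
    have "rho G i j + c \<le> (rho G i k + c) + (rho G j k + c)"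
      using rho_triangle[OF conn, of i k j] rho_sym[OF conn, of j k] that \<open>0 \<le> c\<close> pverts_eq by auto
    then have "(rho G i j + c) / K \<le> (rho G i k + c) / K + (rho G j k + c) / K"
      using \<open>0 < K\<close> by (simp add: add_divide_distrib[symmetric] divide_right_mono)
    then show ?thesis using y that by simp
  qed
  moreover have "coord y i j + coord y i k + coord y j k \<le> 2"
    if "i \<in> {1..n}" "j \<in> {1..n}" "k \<in> {1..n}" "i < j" "j < k" for i j k
  proof -
    have "rho G i j \<le> rho_max G" "rho G i k \<le> rho_max G" "rho G j k \<le> rho_max G"
      using rho_le_rho_max that pverts_eq by auto
    then have "((rho G i j + c) + (rho G i k + c) + (rho G j k + c)) / K \<le> 2"
      using perimeter \<open>0 < K\<close> by (simp add: divide_simps)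
    then show ?thesis using y that by (simp add: add_divide_distrib)
  qed
  moreover have "(\<Sum>(i, j)\<in>index_pairs n. coord y i j) = real n ^ 2 / 4"
  proof -
    \<comment> \<open>A connected graph has a vertex; this allows division by \<open>n\<close>
      below.\<close>
    have n: "0 < n" using conn pverts_eq
      by (cases n) (auto simp: Digraph_Component.connected_def strongly_connected_def)
    have avg: "(\<Sum>(i, j)\<in>index_pairs n. rho G i j) = real n ^ 2 * rho_avg G / 2"
      using n by (simp add: rho_avg_def pverts_eq Let_def)
    have "(\<Sum>(i, j)\<in>index_pairs n. coord y i j) = (\<Sum>(i, j)\<in>index_pairs n. (rho G i j + c) / K)"
      by (intro sum.cong) (auto simp: coord_index_pair y_def)
    also have "\<dots> = ((\<Sum>(i, j)\<in>index_pairs n. rho G i j) + real (card (index_pairs n)) * c) / K"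
      by (simp add: case_prod_beta sum_divide_distrib[symmetric] sum.distrib)
    \<comment> \<open>This identity dictates \<open>K\<close>: the distances sum to
      \<open>n^2 * rho_avg G / 2\<close>, and the shifts to
      \<open>c * n * (n - 1) / 2\<close>.\<close>
    also have "(\<Sum>(i, j)\<in>index_pairs n. rho G i j) + real (card (index_pairs n)) * c
        = real n ^ 2 / 4 * K"
      unfolding avg card_index_pairs K using n by (simp add: field_simps power2_eq_square)
    finally show ?thesis using \<open>0 < K\<close> by simp
  qed
  ultimately show ?thesis
    unfolding lp_feasible_def by (auto simp: y_def)
qed

lemma lp_objective_metric_le:
  assumes "0 < K"
  shows "lp_objective G (restrict (\<lambda>(i, j). (rho G i j + c) / K) (index_pairs n))
    \<le> (1 + c) / K * real (card (edges G))" (is "lp_objective G ?y \<le> _")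
proof -
  have "lp_objective G ?y
      \<le> (\<Sum>(i, j)\<in>index_pairs n. (1 + c) / K * (if {i, j} \<in> edges G then 1 else 0))"
    unfolding lp_objective_def pverts_eq
    using rho_le_1[OF conn] assms
    by (auto intro!: sum_mono divide_right_mono simp: coord_index_pair)
  also have "\<dots> = (1 + c) / K * (\<Sum>(i, j)\<in>index_pairs n. if {i, j} \<in> edges G then 1 else 0)"
    unfolding sum_distrib_left by (intro sum.cong) auto
  also have "(\<Sum>(i, j)\<in>index_pairs n. if {i, j} \<in> edges G then 1 else 0) = real (card (edges G))"
    using sum_edge_indicator edges_subset pverts_eq by simp
  finally show ?thesis .
qed

text \<open>Distinct vertices are at positive distance, and two vertices already give an index pair.
  This makes \<open>K\<close> positive in the final argument.\<close>

lemma rho_avg_pos: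
  assumes "2 \<le> n"
  shows "0 < rho_avg G"
proof -
  have "0 < (\<Sum>(i, j)\<in>index_pairs n. rho G i j)"
  proof (rule sum_pos)
    show "finite (index_pairs n)" by (rule finite_index_pairs)
    have "(1, 2) \<in> index_pairs n" using assms unfolding index_pairs_def by simp
    then show "index_pairs n \<noteq> {}" by blast
    fix p assume "p \<in> index_pairs n"
    then obtain i j where "p = (i, j)" "i \<in> pverts G" "j \<in> pverts G" "i \<noteq> j"
      unfolding pverts_eq index_pairs_def by auto
    then show "0 < (case p of (i, j) \<Rightarrow> rho G i j)" using rho_pos[OF conn] by simp
  qed
  then show ?thesis using assms by (simp add: rho_avg_def pverts_eq)
qed

end

section \<open>Choice of the shift and non-optimality of the cut vector\<close>

theorem theorem5:
  fixes G :: "nat pair_pre_digraph" and n :: nat and V1 V2 :: "nat set"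
  assumes "pair_graph G"
    and "pverts G = {1..n}"
    and "Digraph_Component.connected (with_proj G)"
    and "n \<ge> 5"
    and "bisection (pverts G) V1 V2"
    and "(1 + c_graph G) / (2 * rho_avg G + 2 * c_graph G * (1 - 1 / real n))
           * real (card (edges G)) < real (card (cut_edges G V1 V2))"
  shows "\<not> lp_recovers G V1 V2"
proof
  assume "lp_recovers G V1 V2"
  interpret numbered_connected_graph G n
    using assms(1-3) by (intro numbered_connected_graph.intro numbered_connected_graph_axioms.intro)
  define c where "c = c_graph G"
  define K where "K = 2 * rho_avg G + 2 * c * (1 - 1 / real n)"
  define y where "y = restrict (\<lambda>(i, j). (rho G i j + c) / K) (index_pairs n)"
  \<comment> \<open>Positivity of this denominator is what allows the quotient in
    \<open>c_graph\<close> to be cleared.\<close>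
  have n: "0 < 1 - 4 / real n" using \<open>n \<ge> 5\<close> by (simp add: field_simps)
  have c: "0 \<le> c" by (simp add: c_def c_graph_def)
  have "(3 * rho_max G - 4 * rho_avg G) / (1 - 4 / real n) \<le> c"
    by (simp add: c_def c_graph_def assms(2))
  then have "3 * rho_max G - 4 * rho_avg G \<le> c * (1 - 4 / real n)"
    using n by (simp only: pos_divide_le_eq)
  \<comment> \<open>Here \<open>2 * K - 3 * c = 4 * rho_avg G + c * (1 - 4 / n)\<close>.\<close>
  then have perimeter: "3 * rho_max G + 3 * c \<le> 2 * K"
    by (simp add: K_def algebra_simps)
  have "0 < rho_avg G" using rho_avg_pos assms(4) by simp
  moreover have "0 \<le> c * (1 - 1 / real n)" using c assms(4) by simp
  ultimately have K: "0 < K" by (simp add: K_def)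
  have "lp_feasible n y"
    unfolding y_def using metric_lp_feasible[OF c K K_def perimeter] .
  moreover have "lp_objective G y < lp_objective G (cut_vector n V1 V2)"
    using lp_objective_metric_le[OF K, of c] assms(6)
    by (simp add: lp_objective_cut_vector[OF assms(5)] y_def K_def c_def)
  ultimately have "\<not> lp_optimal G (cut_vector n V1 V2)"
    by (auto simp: lp_optimal_def is_arg_min_def assms(2))
  with \<open>lp_recovers G V1 V2\<close> show False by (simp add: lp_recovers_def assms(2))
qed

end
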